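(* Let $n\ge 1$ and $H\ge 1$ be integers with $n\le H$. Consider $n$ planar nonholonomic agents with shifted positions $\bar{\mathbf{x}}_i\in\mathbb{R}^2$ and orientations $\theta_i\in\mathbb{R}$ satisfying $$\dot{\bar{\mathbf{x}}}_i=\mathbf{R}_i(\theta_i)(\mathbf{u}_i+\mathbf{d}_i)=\bar{\mathbf{u}}_i+\bar{\mathbf{d}}_i,\qquad \dot\theta_i=\omega_i+d_{i2},\qquad i=1,\dots,n,$$ where $\mathbf{u}_i=[v_i,\omega_i]^{\mathsf T}$ is the input, $\mathbf{d}_i=[d_{i1},d_{i2}]^{\mathsf T}\in\mathbb{R}^2$ is an (unknown) constant disturbance, $\bar{\mathbf{u}}_i=\mathbf{R}_i(\theta_i)\mathbf{u}_i$ and $\bar{\mathbf{d}}_i=\mathbf{R}_i(\theta_i)\mathbf{d}_i$. Let the agents interact over a directed graph that contains a rooted spanning tree, with agent $1$ being the root and the leader, so that the first row of the graph Laplacian $\mathbf{L}$ is zero. Let a static planar curve $\mathbf{c}(s)=\mathbf{G}(s)\boldsymbol{\xi}$, $s\in[0,1]$, be given, with $\boldsymbol{\xi}\in\mathbb{R}^{2H}$ constant, and assume that the matrix $\bar{\mathbf{G}}=[\mathbf{G}(s_1)^{\mathsf T},\dots,\mathbf{G}(s_n)^{\mathsf T}]^{\mathsf T}\in\mathbb{R}^{2n\times 2H}$, $s_i=(i-1)/n$, satisfies $\operatorname{rank}(\bar{\mathbf{G}})=\min\{2n,2H\}$. Let $k_1,k_2>0$ and apply the controller $$\bar{\mathbf{u}}=-k_1\big((\mathbf{L}\otimes\mathbf{I}_2)\bar{\mathbf{G}}\boldsymbol{\xi}_e+(\boldsymbol{\Lambda}\otimes\mathbf{I}_2)\bar{\mathbf{x}}_e\big)-k_2\mathbf{R}\hat{\boldsymbol{\delta}},\qquad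 \dot{\hat{\boldsymbol{\delta}}}=k_2\mathbf{R}^{\mathsf T}\bar{\mathbf{x}}_e .$$ Then: (1) The agents are driven to be uniformly distributed on the curve and the position errors $\bar{\mathbf{x}}_e=\bar{\mathbf{x}}-\bar{\mathbf{G}}\boldsymbol{\xi}$ are asymptotically stable. That is, for every initial condition the closed-loop solution satisfies $\bar{\mathbf{x}}_e(t)\to\mathbf{0}$ as $t\to\infty$ (equivalently $\bar{\mathbf{x}}_i(t)\to\mathbf{c}(s_i)$ for every $i$), and for every $\varepsilon>0$ there is $\eta>0$ such that $\|\bar{\mathbf{x}}_e(0)\|+\|\hat{\boldsymbol{\delta}}(0)-\tfrac{1}{k_2}\mathbf{d}\|<\eta$ implies $\|\bar{\mathbf{x}}_e(t)\|<\varepsilon$ for all $t\ge 0$. (2) The orientations of the agents converge to some constant values: for every initial condition and every $i$, $\lim_{t\to\infty}\theta_i(t)$ exists in $\mathbb{R}$.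
   Context: Agents. Agent $i$ has center position $(x_i,y_i)\in\mathbb{R}^2$ and orientation $\theta_i\in\mathbb{R}$, with $\dot x_i=\cos\theta_i\,(v_i+d_{i1})$, $\dot y_i=\sin\theta_i\,(v_i+d_{i1})$, $\dot\theta_i=\omega_i+d_{i2}$. For a fixed scalar $\ell\neq 0$ (the same for all agents), the shifted position is $\bar{\mathbf{x}}_i=[x_i+\ell\cos\theta_i,\ y_i+\ell\sin\theta_i]^{\mathsf T}$, and $$\mathbf{R}_i(\theta_i)=\begin{bmatrix}\cos\theta_i&-\ell\sin\theta_i\\ \sin\theta_i&\ell\cos\theta_i\end{bmatrix},$$ which is invertible. The actual input is recovered from $\bar{\mathbf{u}}_i$ by $\mathbf{u}_i=\mathbf{R}_i(\theta_i)^{-1}\bar{\mathbf{u}}_i$. Stacked notation. $\bar{\mathbf{x}},\bar{\mathbf{u}},\mathbf{d},\hat{\boldsymbol{\delta}}\in\mathbb{R}^{2n}$ are obtained by stacking $\bar{\mathbf{x}}_i,\bar{\mathbf{u}}_i,\mathbf{d}_i,\hat{\boldsymbol{\delta}}_i\in\mathbb{R}^2$ for $i=1,\dots,n$. $\mathbf{R}=\operatorname{diag}(\mathbf{R}_1(\theta_1),\dots,\mathbf{R}_n(\theta_n))\in\mathbb{R}^{2n\times 2n}$ is block diagonal. $\boldsymbol{\Lambda}=\operatorname{diag}(1,0,\dots,0)\in\mathbb{R}^{n\times n}$. $\otimes$ is the Kronecker product. Curve. $\mathbf{G}(s)\in\mathbb{R}^{2\times 2H}$ is a matrix of basis functions of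 the normalized length parameter $s\in[0,1]$, $H$ is the number of basis functions, and $\boldsymbol{\xi}\in\mathbb{R}^{2H}$ is the vector of curve coefficients. Agent $i$ is assigned the length parameter $s_i=(i-1)/n$; "uniformly distributed on the curve" refers to this uniform assignment of length parameters. The position error is $\bar{\mathbf{x}}_e=\bar{\mathbf{x}}-\bar{\mathbf{G}}\boldsymbol{\xi}$ and the curve coefficient error is $\boldsymbol{\xi}_e=\bar{\mathbf{G}}^{+}\bar{\mathbf{x}}-\boldsymbol{\xi}$, where $\bar{\mathbf{G}}^{+}$ is the Moore–Penrose pseudoinverse of $\bar{\mathbf{G}}$. Graph. The interaction graph has nodes $\{1,\dots,n\}$ and weights $a_{ij}\ge 0$ (with $a_{ii}=0$), where $a_{ij}>0$ means that $j$ is a neighbor of $i$, i.e. agent $i$ receives information from agent $j$. The Laplacian $\mathbf{L}=[l_{ij}]$ is $l_{ii}=\sum_{j=1}^n a_{ij}$ and $l_{ij}=-a_{ij}$ for $i\ne j$. The graph contains a rooted spanning tree with root $1$ if from node $1$ every other node can be reached along directed paths following the information flow (an arc from $j$ to $i$ whenever $a_{ij}>0$). Componentwise, the controller is $\bar{\mathbf{u}}_1=-k_1(\bar{\mathbf{x}}_1-\mathbf{G}(s_1)\boldsymbol{\xi})-k_2\mathbf{R}_1\hat{\boldsymbol{\delta}}_1$ for the leader and $\bar{\mathbf{u}}_i=-k_1\sum_{j}a_{ij}(\mathbf{G}(s_i)-\mathbf{G}(s_j))\boldsymbol{\xi}_e-k_2\mathbf{R}_i\hat{\boldsymbol{\delta}}_i$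 for the followers $i\ge 2$, with $\dot{\hat{\boldsymbol{\delta}}}_i=k_2\mathbf{R}_i^{\mathsf T}(\bar{\mathbf{x}}_i-\mathbf{G}(s_i)\boldsymbol{\xi})$ for all $i$. *)

theory Defs
  imports "HOL-Analysis.Analysis"
begin

text \<open>
  Agents are the elements of a finite type \<open>'n\<close>, so \<open>n = CARD('n)\<close>; a vector in
  \<open>\<real>\<^sup>2\<^sup>n\<close> has index type \<open>'n \<times> 2\<close>, the entry \<open>(i, c)\<close> being the \<open>c\<close>-th coordinate of the
  block of agent \<open>i\<close>.  Likewise \<open>\<real>\<^sup>2\<^sup>H\<close> has index type \<open>'h \<times> 2\<close> with \<open>H = CARD('h)\<close>.
  The numbering of the agents by \<open>1, \<dots>, n\<close> is a bijection \<open>num\<close>.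
\<close>

definition kronecker :: "real^'b::finite^'a::finite \<Rightarrow> real^'d::finite^'c::finite \<Rightarrow> real^('b \<times> 'd)^('a \<times> 'c)"
    (infixl "\<otimes>\<^sub>K" 75) where
  "A \<otimes>\<^sub>K B = (\<chi> p q. A $ fst p $ fst q * B $ snd p $ snd q)"

definition block_diag :: "('n::finite \<Rightarrow> real^'b::finite^'a::finite) \<Rightarrow> real^('n \<times> 'b)^('n \<times> 'a)" where
  "block_diag B = (\<chi> p q. if fst p = fst q then B (fst p) $ snd p $ snd q else 0)"

definition block :: "real^('n::finite \<times> 'a::finite) \<Rightarrow> 'n \<Rightarrow> real^'a" where
  "block x i = (\<chi> c. x $ (i, c))"

definition is_moore_penrose :: "real^'b::finite^'a::finite \<Rightarrow> real^'a^'b \<Rightarrow> bool" where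
  "is_moore_penrose A X \<longleftrightarrow>
     A ** X ** A = A \<and> X ** A ** X = X \<and>
     transpose (A ** X) = A ** X \<and> transpose (X ** A) = X ** A"

definition pinv :: "real^'b::finite^'a::finite \<Rightarrow> real^'a^'b" where
  "pinv A = (THE X. is_moore_penrose A X)"

text \<open>
  \<open>a $ i $ j\<close> is the weight with which agent \<open>i\<close> receives information from agent \<open>j\<close>,
  so arcs of the information flow go from \<open>j\<close> to \<open>i\<close>.
\<close>

definition laplacian :: "real^'n::finite^'n \<Rightarrow> real^'n^'n" where
  "laplacian a = (\<chi> i j. if i = j then (\<Sum>k\<in>UNIV. a $ i $ k) else - a $ i $ j)"

definition info_arcs :: "real^'n::finite^'n \<Rightarrow> ('n \<times> 'n) set" where
  "info_arcs a = {(j, i). a $ i $ j > 0}"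

definition rooted_spanning_tree :: "real^'n::finite^'n \<Rightarrow> 'n \<Rightarrow> bool" where
  "rooted_spanning_tree a r \<longleftrightarrow> (\<forall>i. (r, i) \<in> (info_arcs a)\<^sup>*)"

definition leader_matrix :: "'n::finite \<Rightarrow> real^'n^'n" where
  "leader_matrix r = (\<chi> i j. if i = r \<and> j = r then 1 else 0)"

definition length_param :: "('n::finite \<Rightarrow> nat) \<Rightarrow> 'n \<Rightarrow> real" where
  "length_param num i = (real (num i) - 1) / real CARD('n)"

definition curve :: "(real \<Rightarrow> real^('h::finite \<times> 2)^2) \<Rightarrow> real^('h \<times> 2) \<Rightarrow> real \<Rightarrow> real^2" where
  "curve G \<xi> s = G s *v \<xi>"

definition Gbar ::
    "(real \<Rightarrow> real^('h::finite \<times> 2)^2) \<Rightarrow> ('n::finite \<Rightarrow> nat) \<Rightarrow> real^('h \<times> 2)^('n \<times> 2)" where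
  "Gbar G num = (\<chi> p. G (length_param num (fst p)) $ snd p)"

definition position_error ::
    "(real \<Rightarrow> real^('h::finite \<times> 2)^2) \<Rightarrow> ('n::finite \<Rightarrow> nat) \<Rightarrow> real^('h \<times> 2) \<Rightarrow>
     real^('n \<times> 2) \<Rightarrow> real^('n \<times> 2)" where
  "position_error G num \<xi> x = x - Gbar G num *v \<xi>"

definition coefficient_error ::
    "(real \<Rightarrow> real^('h::finite \<times> 2)^2) \<Rightarrow> ('n::finite \<Rightarrow> nat) \<Rightarrow> real^('h \<times> 2) \<Rightarrow>
     real^('n \<times> 2) \<Rightarrow> real^('h \<times> 2)" where
  "coefficient_error G num \<xi> x = pinv (Gbar G num) *v x - \<xi>"

definition agent_R :: "real \<Rightarrow> real \<Rightarrow> real^2^2" where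
  "agent_R l \<theta> = vector [vector [cos \<theta>, - l * sin \<theta>], vector [sin \<theta>, l * cos \<theta>]]"

definition stacked_R :: "real \<Rightarrow> real^'n::finite \<Rightarrow> real^('n \<times> 2)^('n \<times> 2)" where
  "stacked_R l \<theta> = block_diag (\<lambda>i. agent_R l (\<theta> $ i))"

definition controller ::
    "real \<Rightarrow> real \<Rightarrow> real \<Rightarrow> real^'n::finite^'n \<Rightarrow> 'n \<Rightarrow> (real \<Rightarrow> real^('h::finite \<times> 2)^2) \<Rightarrow> ('n \<Rightarrow> nat) \<Rightarrow>
     real^('h \<times> 2) \<Rightarrow> real^('n \<times> 2) \<Rightarrow> real^'n \<Rightarrow> real^('n \<times> 2) \<Rightarrow> real^('n \<times> 2)" where
  "controller k1 k2 l a r G num \<xi> x \<theta> \<delta> =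
     - k1 *\<^sub>R ((laplacian a \<otimes>\<^sub>K (mat 1 :: real^2^2)) *v (Gbar G num *v coefficient_error G num \<xi> x)
            + (leader_matrix r \<otimes>\<^sub>K (mat 1 :: real^2^2)) *v position_error G num \<xi> x)
     - k2 *\<^sub>R (stacked_R l \<theta> *v \<delta>)"

text \<open>
  Closed-loop trajectories on \<open>[0, \<infinity>)\<close>: \<open>x\<close> are the shifted positions, \<open>\<theta>\<close> the orientations,
  \<open>\<delta>\<close> the disturbance estimates and \<open>u\<close> the actual inputs, with \<open>u $ (i, 1) = v\<^sub>i\<close> and
  \<open>u $ (i, 2) = \<omega>\<^sub>i\<close>.  The equation \<open>R u = controller\<close> determines \<open>u\<close>, as \<open>R\<close> is invertible
  for \<open>l \<noteq> 0\<close>.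
\<close>

definition closed_loop_solution ::
    "real \<Rightarrow> real \<Rightarrow> real \<Rightarrow> real^'n::finite^'n \<Rightarrow> 'n \<Rightarrow> (real \<Rightarrow> real^('h::finite \<times> 2)^2) \<Rightarrow> ('n \<Rightarrow> nat) \<Rightarrow>
     real^('h \<times> 2) \<Rightarrow> real^('n \<times> 2) \<Rightarrow>
     (real \<Rightarrow> real^('n \<times> 2)) \<Rightarrow> (real \<Rightarrow> real^'n) \<Rightarrow> (real \<Rightarrow> real^('n \<times> 2)) \<Rightarrow>
     (real \<Rightarrow> real^('n \<times> 2)) \<Rightarrow> bool" where
  "closed_loop_solution k1 k2 l a r G num \<xi> d x \<theta> \<delta> u \<longleftrightarrow>
     (\<forall>t\<ge>0.
        (x has_vector_derivative stacked_R l (\<theta> t) *v (u t + d)) (at t within {0..}) \<and>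
        (\<forall>i. ((\<lambda>\<tau>. \<theta> \<tau> $ i) has_real_derivative u t $ (i, 2) + d $ (i, 2)) (at t within {0..})) \<and>
        stacked_R l (\<theta> t) *v u t = controller k1 k2 l a r G num \<xi> (x t) (\<theta> t) (\<delta> t) \<and>
        (\<delta> has_vector_derivative
           k2 *\<^sub>R (transpose (stacked_R l (\<theta> t)) *v position_error G num \<xi> (x t)))
          (at t within {0..}))"

end

theory Submission imports Defs begin

text \<open>
  Since \<open>n \<le> H\<close>, the matrix \<open>Gbar\<close> has full row rank, hence \<open>Gbar Gbar\<^sup>+ = I\<close> and, with
  \<open>M = L + \<Lambda>\<close> and \<open>e = \<delta> - d / k2\<close>, the closed loop becomes
  \<open>x' = - k1 (M \<otimes> I) x - k2 R e\<close>, \<open>e' = k2 R\<^sup>T x\<close> for the position error \<open>x\<close>.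
  A minimum principle along the spanning tree shows that \<open>M y \<ge> 0\<close> implies \<open>y \<ge> 0\<close>, so \<open>M\<close> is a
  nonsingular M-matrix and \<open>P M + M\<^sup>T P\<close> is positive definite for a positive diagonal matrix
  \<open>P\<close>.  As \<open>P \<otimes> I\<close> commutes with the block diagonal \<open>R\<close>, the function
  \<open>V = x\<^sup>T (P \<otimes> I) x + e\<^sup>T (P \<otimes> I) e\<close> is nonincreasing, which gives stability.
  Along a fixed solution \<open>N V + x \<bullet> R e\<close> is a strict Lyapunov function for large \<open>N\<close>; hence
  \<open>x\<close>, \<open>e\<close> and the angular velocities decay exponentially, and the orientations converge.
\<close>

section \<open>Linear algebra\<close>

lemma moore_penrose_unique:
  fixes A :: "real^'b::finite^'a::finite"
  assumes X: "is_moore_penrose A X" and Y: "is_moore_penrose A Y"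
  shows "X = Y"
proof -
  have x: "A ** X ** A = A" "X ** A ** X = X"
      "transpose (A ** X) = A ** X" "transpose (X ** A) = X ** A"
    and y: "A ** Y ** A = A" "Y ** A ** Y = Y"
      "transpose (A ** Y) = A ** Y" "transpose (Y ** A) = Y ** A"
    using X Y by (auto simp: is_moore_penrose_def)
  \<comment> \<open>Both \<open>A ** X\<close> and \<open>A ** Y\<close> are symmetric, so
    transposing \<open>(A ** Y) ** (A ** X) = A ** X\<close> swaps the factors, and
    \<open>A ** X ** A = A\<close> then absorbs the left one. The products with \<open>A\<close> on
    the right agree by the mirrored argument.\<close>
  have "A ** X = transpose (A ** Y ** A ** X)"
    using x y by simp
  also have "\<dots> = transpose (A ** X) ** transpose (A ** Y)"
    by (metis matrix_mul_assoc matrix_transpose_mul)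
  also have "\<dots> = A ** Y"
    using x y by (metis matrix_mul_assoc)
  finally have AX: "A ** X = A ** Y" .
  have "X ** A = transpose (X ** A ** Y ** A)"
    using x y by (metis matrix_mul_assoc)
  also have "\<dots> = transpose (Y ** A) ** transpose (X ** A)"
    by (metis matrix_mul_assoc matrix_transpose_mul)
  also have "\<dots> = Y ** A"
    using x y by (metis matrix_mul_assoc)
  finally have XA: "X ** A = Y ** A" .
  have "X = X ** A ** X" using x by simp
  also have "\<dots> = Y ** A ** X" using XA by simp
  also have "\<dots> = Y ** A ** Y" using AX by (metis matrix_mul_assoc)
  also have "\<dots> = Y" using y by simp
  finally show ?thesis .
qed

lemma invertible_if_kernel_trivial:
  fixes A :: "real^'n::finite^'n"
  assumes "\<And>x. A *v x = 0 \<Longrightarrow> x = 0"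
  shows "invertible A"
  using assms matrix_left_invertible_ker invertible_left_inverse by blast

text \<open>Full row rank makes the Gram matrix \<open>A ** transpose A\<close> invertible. With
  \<open>B\<close> its inverse, \<open>transpose A ** B\<close> is a right inverse of
  \<open>A\<close> that satisfies the Penrose conditions, so uniqueness identifies it with
  \<open>pinv A\<close>.\<close>

lemma pinv_right_inverse:
  fixes A :: "real^'b::finite^'a::finite"
  assumes "rank A = CARD('a)"
  shows "A ** pinv A = mat 1"
proof -
  have "inj ((*v) (transpose A))"
    using assms full_rank_injective[of "transpose A"] by (simp add: rank_transpose)
  have "invertible (A ** transpose A)"
  proof (rule invertible_if_kernel_trivial)
    fix y assume "(A ** transpose A) *v y = 0"
    then have "A *v (transpose A *v y) = 0"
      by (simp only: matrix_vector_mul_assoc)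
    then have "y \<bullet> (A *v (transpose A *v y)) = 0"
      by (simp only: inner_zero_right)
    then have "(transpose A *v y) \<bullet> (transpose A *v y) = 0"
      by (metis dot_lmul_matrix matrix_transpose_mul transpose_matrix_vector transpose_transpose)
    then have "transpose A *v y = transpose A *v 0" by simp
    then show "y = 0" using \<open>inj _\<close> by (rule injD[rotated])
  qed
  then obtain B where B: "A ** transpose A ** B = mat 1" "B ** (A ** transpose A) = mat 1"
    by (auto simp: invertible_def)
  \<comment> \<open>Symmetry of \<open>B\<close> gives the only Penrose condition that does not
    follow from \<open>A ** X = mat 1\<close>: symmetry of
    \<open>X ** A = transpose A ** B ** A\<close>.\<close>
  have "transpose B = B"
  proof -
    have "transpose B ** (A ** transpose A) = mat 1"
      by (metis B(1) matrix_transpose_mul transpose_mat transpose_transpose)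
    then show ?thesis
      by (metis B(1) matrix_mul_assoc matrix_mul_lid matrix_mul_rid)
  qed
  define X where "X = transpose A ** B"
  have AX: "A ** X = mat 1" using B(1) by (simp add: X_def matrix_mul_assoc)
  have "transpose (X ** A) = X ** A"
    using \<open>transpose B = B\<close> by (simp add: X_def matrix_transpose_mul transpose_transpose matrix_mul_assoc)
  then have mp: "is_moore_penrose A X"
    by (simp add: is_moore_penrose_def AX transpose_mat flip: matrix_mul_assoc)
  then have "pinv A = X"
    unfolding pinv_def by (rule the_equality) (rule moore_penrose_unique[OF _ mp])
  then show ?thesis using AX by simp
qed

section \<open>Monotone Z-matrices and diagonal Lyapunov weights\<close>

lemma inverse_nonneg_rows:
  fixes M B :: "real^'n::finite^'n"
  assumes mono: "\<And>y. (\<And>i. (M *v y) $ i \<ge> 0) \<Longrightarrow> (\<And>i. y $ i \<ge> 0)"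
    and MB: "M ** B = mat 1"
  shows "B $ i $ j \<ge> 0"
proof -
  \<comment> \<open>A column of the inverse solves a system whose right-hand side is a unit vector,
    hence nonnegative, so \<open>mono\<close> applies to it.\<close>
  have "M *v (column j B) = column j (mat 1)"
    using MB by (metis matrix_vector_mul_assoc matrix_vector_mult_basis)
  then have "column j B $ i \<ge> 0"
    by (intro mono[of "column j B" i]) (simp add: column_def mat_def)
  then show ?thesis by (simp add: column_def)
qed

text \<open>A row of a matrix with a right inverse cannot vanish, so nonnegative entries in it have
  a positive sum.\<close>

lemma matrix_vector_mult_one_pos:
  fixes B :: "real^'n::finite^'n"
  assumes nonneg: "\<And>j. B $ i $ j \<ge> 0" and "B ** C = mat 1"
  shows "(B *v 1) $ i > 0"
proof -
  have "\<exists>j. B $ i $ j \<noteq> 0"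
  proof (rule ccontr)
    assume "\<nexists>j. B $ i $ j \<noteq> 0"
    then have "(B ** C) $ i $ i = 0" by (simp add: matrix_matrix_mult_def)
    then show False using assms(2) by (simp add: mat_def)
  qed
  then obtain j where "B $ i $ j > 0" using nonneg by (metis less_eq_real_def)
  then have "(\<Sum>j\<in>UNIV. B $ i $ j) > 0"
    by (intro sum_pos2[where i=j]) (use nonneg in auto)
  then show ?thesis by (simp add: matrix_vector_mult_def)
qed

text \<open>Multiplying \<open>y i * y j \<le> ((y i)\<^sup>2 + (y j)\<^sup>2) / 2\<close> by a
  nonpositive entry reverses it, and on the diagonal both sides agree. Collecting the squares leaves
  half of each row sum plus half of each column sum.\<close>

lemma Z_matrix_quadratic_form_bound:
  fixes N :: "real^'n::finite^'n"
  assumes "\<And>i j. i \<noteq> j \<Longrightarrow> N $ i $ j \<le> 0"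
  shows "(\<Sum>i\<in>UNIV. ((\<Sum>j\<in>UNIV. N $ i $ j) + (\<Sum>j\<in>UNIV. N $ j $ i)) / 2 * (y i)\<^sup>2)
         \<le> (\<Sum>i\<in>UNIV. \<Sum>j\<in>UNIV. N $ i $ j * y i * y j)"
proof -
  have "N $ i $ j * ((y i)\<^sup>2 + (y j)\<^sup>2) / 2 \<le> N $ i $ j * y i * y j" for i j
  proof (cases "i = j")
    case False
    have "y i * y j \<le> ((y i)\<^sup>2 + (y j)\<^sup>2) / 2"
      using sum_squares_bound[of "y i" "y j"] by simp
    from mult_left_mono_neg[OF this assms[OF False]] show ?thesis by (simp add: mult.assoc)
  qed (simp add: power2_eq_square)
  then have "(\<Sum>i\<in>UNIV. \<Sum>j\<in>UNIV. N $ i $ j * ((y i)\<^sup>2 + (y j)\<^sup>2) / 2)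
      \<le> (\<Sum>i\<in>UNIV. \<Sum>j\<in>UNIV. N $ i $ j * y i * y j)"
    by (intro sum_mono) auto
  moreover have "(\<Sum>i\<in>UNIV. \<Sum>j\<in>UNIV. N $ i $ j * ((y i)\<^sup>2 + (y j)\<^sup>2) / 2)
      = (\<Sum>i\<in>UNIV. (\<Sum>j\<in>UNIV. N $ i $ j) / 2 * (y i)\<^sup>2)
        + (\<Sum>i\<in>UNIV. \<Sum>j\<in>UNIV. N $ i $ j / 2 * (y j)\<^sup>2)"
    by (simp add: sum_distrib_right sum_divide_distrib flip: sum.distrib)
       (simp add: field_simps)
  moreover have "(\<Sum>i\<in>UNIV. \<Sum>j\<in>UNIV. N $ i $ j / 2 * (y j)\<^sup>2)
      = (\<Sum>i\<in>UNIV. (\<Sum>j\<in>UNIV. N $ j $ i) / 2 * (y i)\<^sup>2)"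
    by (subst sum.swap) (simp add: sum_distrib_right sum_divide_distrib)
  ultimately show ?thesis
    by (simp add: add_divide_distrib distrib_right sum.distrib)
qed

text \<open>This is diagonal stability of nonsingular M-matrices. Scaling the rows by
  \<open>\<eta>\<close> and the columns by \<open>\<xi>\<close>, the solutions of the transposed and
  the original system with right-hand side \<open>1\<close>, makes all row and column sums positive,
  so the preceding bound becomes positive definite. Undoing the column scaling produces the weights
  \<open>\<eta> / \<xi>\<close>.\<close>

lemma monotone_Z_matrix_diagonal_Lyapunov:
  fixes M :: "real^'n::finite^'n"
  assumes offdiag: "\<And>i j. i \<noteq> j \<Longrightarrow> M $ i $ j \<le> 0"
    and mono: "\<And>y. (\<And>i. (M *v y) $ i \<ge> 0) \<Longrightarrow> (\<And>i. y $ i \<ge> 0)"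
  obtains p :: "'n \<Rightarrow> real" and c :: real where "\<And>i. p i > 0" "c > 0"
    "\<And>y. c * (\<Sum>i\<in>UNIV. (y $ i)\<^sup>2) \<le> (\<Sum>i\<in>UNIV. p i * y $ i * (M *v y) $ i)"
proof -
  \<comment> \<open>Monotonicity applied to both \<open>y\<close> and \<open>- y\<close> leaves only
    zero in the kernel.\<close>
  have "invertible M"
  proof (rule invertible_if_kernel_trivial)
    fix y assume "M *v y = 0"
    moreover from this have "M *v (- y) = 0"
      using linear_neg[OF matrix_vector_mul_linear[of M], of y] by simp
    ultimately have "y $ i \<ge> 0" "(- y) $ i \<ge> 0" for i
      using mono[of y i] mono[of "- y" i] by simp_all
    then show "y = 0" by (simp add: vec_eq_iff) (meson antisym)
  qed
  then obtain B where MB: "M ** B = mat 1" and BM: "B ** M = mat 1"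
    by (auto simp: invertible_def)
  have B: "B $ i $ j \<ge> 0" for i j
    using mono MB by (rule inverse_nonneg_rows)
  define \<xi> \<eta> where "\<xi> = B *v 1" and "\<eta> = transpose B *v 1"
  have \<xi>: "\<xi> $ i > 0" for i
    unfolding \<xi>_def using B BM by (rule matrix_vector_mult_one_pos)
  have BM': "transpose B ** transpose M = mat 1"
    by (metis MB matrix_transpose_mul transpose_mat)
  have MB': "transpose M ** transpose B = mat 1"
    by (metis BM matrix_transpose_mul transpose_mat)
  have \<eta>: "\<eta> $ i > 0" for i
    unfolding \<eta>_def using _ BM' by (rule matrix_vector_mult_one_pos) (simp add: B transpose_def)
  have "M *v \<xi> = 1" "transpose M *v \<eta> = 1"
    by (simp_all only: \<xi>_def \<eta>_def matrix_vector_mul_assoc MB MB' matrix_vector_mul_lid)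
  then have M\<xi>: "(\<Sum>j\<in>UNIV. M $ i $ j * \<xi> $ j) = 1" and M\<eta>: "(\<Sum>j\<in>UNIV. M $ j $ i * \<eta> $ j) = 1" for i
    by (simp_all add: vec_eq_iff matrix_vector_mult_def transpose_def)
  define N :: "real^'n^'n" where "N = (\<chi> i j. \<eta> $ i * M $ i $ j * \<xi> $ j)"
  have rows: "(\<Sum>j\<in>UNIV. N $ i $ j) = \<eta> $ i" for i
    using M\<xi>[of i] by (simp add: N_def mult.assoc flip: sum_distrib_left)
  have cols: "(\<Sum>j\<in>UNIV. N $ j $ i) = \<xi> $ i" for i
    using M\<eta>[of i] by (simp add: N_def mult.commute[of "\<eta> $ _"] flip: sum_distrib_right)
  define p where "p i = \<eta> $ i / \<xi> $ i" for i
  \<comment> \<open>The mean of the \<open>i\<close>-th row and column sums of \<open>N\<close>; the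
    square in the denominator comes from evaluating the form of \<open>N\<close> at
    \<open>y $ i / \<xi> $ i\<close>.\<close>
  define g where "g i = (\<eta> $ i + \<xi> $ i) / 2 / (\<xi> $ i)\<^sup>2" for i
  have g: "g i > 0" for i
    using \<xi>[of i] \<eta>[of i] by (simp add: g_def)
  define c where "c = Min (range g)"
  have c: "c > 0" "c \<le> g i" for i using g by (auto simp: c_def)
  have "c * (\<Sum>i\<in>UNIV. (y $ i)\<^sup>2) \<le> (\<Sum>i\<in>UNIV. p i * y $ i * (M *v y) $ i)" for y
  proof -
    have nz: "\<xi> $ i \<noteq> 0" for i using \<xi>[of i] by simp
    have "c * (\<Sum>i\<in>UNIV. (y $ i)\<^sup>2) \<le> (\<Sum>i\<in>UNIV. g i * (y $ i)\<^sup>2)"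
      unfolding sum_distrib_left using c(2) by (intro sum_mono mult_right_mono) auto
    also have "\<dots> = (\<Sum>i\<in>UNIV. ((\<Sum>j\<in>UNIV. N $ i $ j) + (\<Sum>j\<in>UNIV. N $ j $ i)) / 2 * (y $ i / \<xi> $ i)\<^sup>2)"
      unfolding rows cols g_def by (simp add: power_divide)
    also have "\<dots> \<le> (\<Sum>i\<in>UNIV. \<Sum>j\<in>UNIV. N $ i $ j * (y $ i / \<xi> $ i) * (y $ j / \<xi> $ j))"
      by (rule Z_matrix_quadratic_form_bound)
         (simp add: N_def offdiag \<xi> \<eta> mult_nonneg_nonpos mult_nonpos_nonneg less_imp_le)
    also have "\<dots> = (\<Sum>i\<in>UNIV. p i * y $ i * (M *v y) $ i)"
      unfolding matrix_vector_mult_def using nz by (simp add: N_def p_def sum_distrib_left field_simps)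
    finally show ?thesis .
  qed
  with that[of p c] c(1) \<xi> \<eta> show thesis by (simp add: p_def)
qed

section \<open>The Laplacian pinned at the leader\<close>

lemma laplacian_mult:
  "(laplacian a *v y) $ i = (\<Sum>j\<in>UNIV. a $ i $ j * (y $ i - y $ j)) + a $ i $ i * y $ i"
proof -
  have "(laplacian a *v y) $ i
      = (\<Sum>j\<in>UNIV. (if i = j then (\<Sum>k\<in>UNIV. a $ i $ k) * y $ j else 0)
          - (if i = j then 0 else a $ i $ j * y $ j))"
    by (auto simp: laplacian_def matrix_vector_mult_def intro!: sum.cong)
  also have "\<dots> = (\<Sum>k\<in>UNIV. a $ i $ k) * y $ i - (\<Sum>j\<in>UNIV - {i}. a $ i $ j * y $ j)"
    by (simp add: sum_subtractf sum.If_cases Compl_eq_Diff_UNIV Collect_neg_eq)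
  \<comment> \<open>The diagonal of \<open>laplacian\<close> counts a loop weight that no
    off-diagonal entry subtracts, hence the extra term \<open>a $ i $ i * y $ i\<close>.\<close>
  also have "(\<Sum>j\<in>UNIV - {i}. a $ i $ j * y $ j) = (\<Sum>j\<in>UNIV. a $ i $ j * y $ j) - a $ i $ i * y $ i"
    by (simp add: sum_diff1)
  finally show ?thesis
    by (simp add: right_diff_distrib sum_subtractf sum_distrib_right)
qed

text \<open>A minimum principle. At an agent other than the root where \<open>y\<close> is minimal,
  the terms \<open>a $ k $ j * (m - y $ j)\<close> are nonpositive with nonnegative sum, so every
  agent it listens to attains the minimum as well. Following a path back to the root makes the
  minimum equal to the root value, which is nonnegative.\<close>

lemma pinned_laplacian_mono:
  fixes a :: "real^'n::finite^'n"
  assumes a: "\<And>i j. a $ i $ j \<ge> 0" and diag: "\<And>i. a $ i $ i = 0"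
    and tree: "rooted_spanning_tree a r" and root: "row r (laplacian a) = 0"
    and My: "\<And>i. ((laplacian a + leader_matrix r) *v y) $ i \<ge> 0"
  shows "y $ i \<ge> 0"
proof -
  have "(leader_matrix r *v y) $ i = (if i = r then y $ r else 0)" for i
    by (simp add: leader_matrix_def matrix_vector_mult_def if_distrib[of "\<lambda>x. x * _"] cong: if_cong)
  then have *: "((laplacian a + leader_matrix r) *v y) $ i
      = (\<Sum>j\<in>UNIV. a $ i $ j * (y $ i - y $ j)) + (if i = r then y $ r else 0)" for i
    by (simp add: matrix_vector_mult_add_rdistrib laplacian_mult diag)
  \<comment> \<open>With no Laplacian contribution in the leader's row, only the pinning term
    remains there, and it is \<open>y $ r\<close>.\<close>
  have "(laplacian a *v y) $ r = 0"
    using root by (simp add: matrix_vector_mult_def row_def vec_eq_iff)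
  then have yr: "y $ r \<ge> 0"
    using My[of r] unfolding * by (simp add: laplacian_mult diag)
  define m where "m = Min (range (($) y))"
  have m: "m \<le> y $ i" for i by (simp add: m_def)
  obtain i0 where "y $ i0 = m"
  proof -
    have "m \<in> range (($) y)" unfolding m_def by (rule Min_in) auto
    then show thesis using that by blast
  qed
  have "(r, i0) \<in> (info_arcs a)\<^sup>*" using tree by (simp add: rooted_spanning_tree_def)
  \<comment> \<open>The assumption that the current node attains \<open>m\<close> takes part in the
    induction: it is handed from \<open>k\<close> to its predecessor \<open>j\<close>, where the
    induction hypothesis applies.\<close>
  then have "m \<ge> 0"
    using \<open>y $ i0 = m\<close>
  proof (induction rule: rtrancl_induct)
    case base
    then show ?case using yr by simp
  next
    case (step j k)
    show ?case
    proof (cases "k = r")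
      case True
      then show ?thesis using yr step by simp
    next
      case False
      then have "0 \<le> (\<Sum>j\<in>UNIV. a $ k $ j * (m - y $ j))"
        using My[of k] unfolding * step.prems by simp
      moreover have "(\<Sum>j\<in>UNIV. a $ k $ j * (m - y $ j)) \<le> a $ k $ j * (m - y $ j)"
      proof -
        have "(\<Sum>j\<in>UNIV - {j}. a $ k $ j * (m - y $ j)) \<le> 0"
          by (intro sum_nonpos mult_nonneg_nonpos a) (simp add: m)
        then show ?thesis by (subst sum.remove[of UNIV j]) auto
      qed
      moreover have "a $ k $ j > 0" using step by (simp add: info_arcs_def)
      ultimately have "0 \<le> m - y $ j"
        using zero_le_mult_iff[of "a $ k $ j" "m - y $ j"] by linarith
      with step.IH m[of j] show ?thesis by simp
    qed
  qed
  then show ?thesis using m[of i] by simp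
qed

section \<open>Decay estimates on the half-line\<close>

lemma nonincreasing_on_halfline:
  fixes f f' :: "real \<Rightarrow> real"
  assumes der: "\<And>t. t \<ge> 0 \<Longrightarrow> (f has_real_derivative f' t) (at t within {0..})"
    and "\<And>t. t \<ge> 0 \<Longrightarrow> f' t \<le> 0" and "0 \<le> s" "s \<le> t"
  shows "f t \<le> f s"
proof (rule DERIV_nonpos_imp_decreasing_open[OF \<open>s \<le> t\<close>])
  fix x assume "s < x" "x < t"
  then have "at x within {0..} = at x"
    using \<open>0 \<le> s\<close> by (intro at_within_interior) simp
  then show "\<exists>y. (f has_real_derivative y) (at x) \<and> y \<le> 0"
    using der[of x] assms(2)[of x] \<open>s < x\<close> \<open>0 \<le> s\<close> by auto
next
  have "continuous_on {0..} f"
    using der by (intro DERIV_continuous_on) auto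
  then show "continuous_on {s..t} f"
    by (rule continuous_on_subset) (use \<open>0 \<le> s\<close> in auto)
qed

lemma exponential_decay:
  fixes W W' :: "real \<Rightarrow> real"
  assumes der: "\<And>t. t \<ge> 0 \<Longrightarrow> (W has_real_derivative W' t) (at t within {0..})"
    and W': "\<And>t. t \<ge> 0 \<Longrightarrow> W' t \<le> - \<gamma> * W t" and "t \<ge> 0"
  shows "W t \<le> W 0 * exp (- \<gamma> * t)"
proof -
  \<comment> \<open>The integrating factor turns the differential inequality into
    monotonicity.\<close>
  have "exp (\<gamma> * t) * W t \<le> exp (\<gamma> * 0) * W 0"
  proof (rule nonincreasing_on_halfline[where f = "\<lambda>t. exp (\<gamma> * t) * W t" and f' = "\<lambda>t. exp (\<gamma> * t) * (W' t + \<gamma> * W t)"])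
    fix t :: real assume "t \<ge> 0"
    show "((\<lambda>t. exp (\<gamma> * t) * W t) has_real_derivative exp (\<gamma> * t) * (W' t + \<gamma> * W t)) (at t within {0..})"
      by (auto intro!: derivative_eq_intros der \<open>t \<ge> 0\<close> simp: algebra_simps)
    show "exp (\<gamma> * t) * (W' t + \<gamma> * W t) \<le> 0"
      using W'[OF \<open>t \<ge> 0\<close>] by (intro mult_nonneg_nonpos) auto
  qed (use \<open>t \<ge> 0\<close> in auto)
  then show ?thesis by (simp add: exp_minus field_simps)
qed

lemma tendsto_exp_neg:
  fixes \<gamma> :: real
  assumes "\<gamma> > 0"
  shows "((\<lambda>t. C * exp (- \<gamma> * t)) \<longlongrightarrow> 0) at_top"
proof -
  have "filterlim (\<lambda>t. - \<gamma> * t) at_bot at_top"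
    using assms by (intro filterlim_tendsto_neg_mult_at_bot[OF tendsto_const]) (auto intro: filterlim_ident)
  then have "((\<lambda>t. exp (- \<gamma> * t)) \<longlongrightarrow> 0) at_top"
    by (rule filterlim_compose[OF exp_at_bot])
  then show ?thesis by (rule tendsto_mult_right_zero)
qed

lemma convergent_if_derivative_exponentially_small:
  fixes \<theta> \<omega> :: "real \<Rightarrow> real"
  assumes der: "\<And>t. t \<ge> 0 \<Longrightarrow> (\<theta> has_real_derivative \<omega> t) (at t within {0..})"
    and \<omega>: "\<And>t. t \<ge> 0 \<Longrightarrow> \<bar>\<omega> t\<bar> \<le> C * exp (- \<gamma> * t)" and "\<gamma> > 0"
  shows "\<exists>c. (\<theta> \<longlongrightarrow> c) at_top"
proof -
  \<comment> \<open>The integral of the derivative bound from \<open>t\<close> to infinity. Hence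
    \<open>\<theta> + h\<close> decreases and \<open>\<theta> - h\<close> increases; the latter
    bounds the former from below, and both differ from \<open>\<theta>\<close> by a vanishing
    amount.\<close>
  define h where "h t = C / \<gamma> * exp (- \<gamma> * t)" for t
  have dh: "(h has_real_derivative - C * exp (- \<gamma> * t)) (at t within {0..})" for t
    unfolding h_def using \<open>\<gamma> > 0\<close> by (auto intro!: derivative_eq_intros)
  have "\<bar>\<omega> 0\<bar> \<le> C" using \<omega>[of 0] by simp
  then have "C \<ge> 0" by linarith
  then have h0: "h t \<ge> 0" for t using \<open>\<gamma> > 0\<close> by (simp add: h_def)
  have up: "\<theta> t + h t \<le> \<theta> s + h s" if "0 \<le> s" "s \<le> t" for s t
  proof (rule nonincreasing_on_halfline[OF _ _ that])
    show "((\<lambda>t. \<theta> t + h t) has_real_derivative \<omega> t + - C * exp (- \<gamma> * t)) (at t within {0..})"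
      if "t \<ge> 0" for t by (intro DERIV_add der dh that)
  qed (use \<omega> in force)
  have lo: "- \<theta> t + h t \<le> - \<theta> s + h s" if "0 \<le> s" "s \<le> t" for s t
  proof (rule nonincreasing_on_halfline[OF _ _ that])
    show "((\<lambda>t. - \<theta> t + h t) has_real_derivative - \<omega> t + - C * exp (- \<gamma> * t)) (at t within {0..})"
      if "t \<ge> 0" for t by (intro DERIV_add DERIV_minus der dh that)
  qed (use \<omega> in force)
  define S where "S = (\<lambda>t. \<theta> t + h t) ` {0..}"
  have bdd: "bdd_below S"
  proof (rule bdd_belowI)
    fix y assume "y \<in> S"
    then obtain t where "t \<ge> 0" "y = \<theta> t + h t" by (auto simp: S_def)
    then show "\<theta> 0 - h 0 \<le> y" using lo[of 0 t] h0[of t] by simp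
  qed
  have "((\<lambda>t. \<theta> t + h t) \<longlongrightarrow> Inf S) at_top"
  proof (rule decreasing_tendsto)
    show "\<forall>\<^sub>F t in at_top. Inf S \<le> \<theta> t + h t"
      using eventually_ge_at_top[of 0]
      by eventually_elim (auto simp: S_def intro!: cInf_lower bdd[unfolded S_def])
  next
    fix b assume "Inf S < b"
    moreover have "S \<noteq> {}" by (auto simp: S_def)
    ultimately obtain s where s: "s \<ge> 0" "\<theta> s + h s < b"
      using cInf_lessD by (metis (no_types, lifting) S_def atLeast_iff imageE)
    show "\<forall>\<^sub>F t in at_top. \<theta> t + h t < b"
      using eventually_ge_at_top[of s]
      by eventually_elim (use s up in force)
  qed
  moreover have "(h \<longlongrightarrow> 0) at_top"
    unfolding h_def using \<open>\<gamma> > 0\<close> by (rule tendsto_exp_neg)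
  ultimately have "((\<lambda>t. \<theta> t + h t - h t) \<longlongrightarrow> Inf S - 0) at_top"
    by (rule tendsto_diff)
  then show ?thesis by auto
qed

text \<open>\<open>V\<close> dissipates only \<open>X\<close>, while \<open>Z\<close> dissipates
  \<open>E\<close> at the price of terms in \<open>X\<close>. A large multiple of \<open>V\<close>
  pays for these and also dominates the indefinite \<open>Z\<close>, so \<open>N * V + Z\<close> is
  comparable to the squared state and decays at a rate proportional to itself.\<close>

lemma Lyapunov_cross_term_decay:
  fixes V V' Z Z' X E :: "real \<Rightarrow> real"
  assumes V: "\<And>t. t \<ge> 0 \<Longrightarrow> (V has_real_derivative V' t) (at t within {0..})"
    and Z: "\<And>t. t \<ge> 0 \<Longrightarrow> (Z has_real_derivative Z' t) (at t within {0..})"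
    and pos: "\<alpha> > 0" "c > 0" "\<mu> > 0"
    and Vlo: "\<And>t. t \<ge> 0 \<Longrightarrow> \<alpha> * ((X t)\<^sup>2 + (E t)\<^sup>2) \<le> V t"
    and Vup: "\<And>t. t \<ge> 0 \<Longrightarrow> V t \<le> \<beta> * ((X t)\<^sup>2 + (E t)\<^sup>2)"
    and Zbd: "\<And>t. t \<ge> 0 \<Longrightarrow> \<bar>Z t\<bar> \<le> K * ((X t)\<^sup>2 + (E t)\<^sup>2)"
    and V': "\<And>t. t \<ge> 0 \<Longrightarrow> V' t \<le> - c * (X t)\<^sup>2"
    and Z': "\<And>t. t \<ge> 0 \<Longrightarrow> Z' t \<le> A * X t * E t + B * (X t)\<^sup>2 - \<mu> * (E t)\<^sup>2"
  obtains \<gamma> C where "\<gamma> > 0" "C \<ge> 0" "\<And>t. t \<ge> 0 \<Longrightarrow> (X t)\<^sup>2 + (E t)\<^sup>2 \<le> C * exp (- \<gamma> * t)"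
proof -
  \<comment> \<open>\<open>D\<close> collects the \<open>X\<close> terms left by Young's inequality
    and by \<open>B\<close>, plus \<open>1\<close> kept as dissipation. In \<open>N\<close>, the
    first summand makes \<open>N * c\<close> cover \<open>D\<close>, the second makes
    \<open>N * \<alpha>\<close> exceed \<open>\<bar>K\<bar>\<close> by at least one.\<close>
  define D where "D = A\<^sup>2 / (2 * \<mu>) + \<bar>B\<bar> + 1"
  define N where "N = D / c + (\<bar>K\<bar> + 1) / \<alpha>"
  have "D > 0" using pos by (simp add: D_def add_nonneg_pos)
  have N: "N * c \<ge> D" "N * \<alpha> \<ge> \<bar>K\<bar> + 1" "N > 0"
  proof -
    have "N * c = D + (\<bar>K\<bar> + 1) / \<alpha> * c" "N * \<alpha> = D / c * \<alpha> + (\<bar>K\<bar> + 1)"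
      using pos by (simp_all only: N_def distrib_right) auto
    then show "N * c \<ge> D" "N * \<alpha> \<ge> \<bar>K\<bar> + 1" using pos \<open>D > 0\<close> by simp_all
    show "N > 0" unfolding N_def using pos \<open>D > 0\<close> by (intro add_pos_nonneg divide_pos_pos divide_nonneg_pos) auto
  qed
  define W where "W t = N * V t + Z t" for t
  \<comment> \<open>The smaller of the dissipation coefficients that survive: \<open>1\<close> for
    \<open>X\<close> and \<open>\<mu> / 2\<close> for \<open>E\<close>.\<close>
  define \<nu> where "\<nu> = min 1 (\<mu> / 2)"
  have "\<nu> > 0" using pos by (simp add: \<nu>_def)
  define b where "b = N * \<bar>\<beta>\<bar> + \<bar>K\<bar> + 1"
  have "b > 0" using N by (simp add: b_def add_nonneg_pos)
  have Wlo: "(X t)\<^sup>2 + (E t)\<^sup>2 \<le> W t" if "t \<ge> 0" for t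
  proof -
    let ?r = "(X t)\<^sup>2 + (E t)\<^sup>2"
    have "(\<bar>K\<bar> + 1) * ?r \<le> N * \<alpha> * ?r" by (intro mult_right_mono N) simp
    also have "\<dots> \<le> N * V t" using Vlo[OF that] N(3) by (simp add: mult.assoc)
    finally have "(\<bar>K\<bar> + 1) * ?r \<le> N * V t" .
    moreover have "\<bar>Z t\<bar> \<le> \<bar>K\<bar> * ?r"
      using Zbd[OF that] by (rule order_trans) (intro mult_right_mono, auto)
    ultimately show ?thesis by (simp add: W_def algebra_simps)
  qed
  have Wup: "W t \<le> b * ((X t)\<^sup>2 + (E t)\<^sup>2)" if "t \<ge> 0" for t
  proof -
    let ?r = "(X t)\<^sup>2 + (E t)\<^sup>2"
    have "\<bar>Z t\<bar> \<le> \<bar>K\<bar> * ?r"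
      using Zbd[OF that] by (rule order_trans) (intro mult_right_mono, auto)
    moreover have "V t \<le> \<bar>\<beta>\<bar> * ?r"
      using Vup[OF that] by (rule order_trans) (intro mult_right_mono, auto)
    then have "N * V t \<le> N * (\<bar>\<beta>\<bar> * ?r)" using N(3) by (intro mult_left_mono) auto
    moreover have "0 \<le> ?r" by simp
    ultimately show ?thesis unfolding W_def b_def distrib_right[where c = ?r] mult.assoc mult_1 by linarith
  qed
  have W': "N * V' t + Z' t \<le> - (\<nu> / b) * W t" if "t \<ge> 0" for t
  proof -
    \<comment> \<open>Young's inequality, weighted so that the mixed term consumes exactly half of
      the damping \<open>\<mu> * (E t)\<^sup>2\<close>.\<close>
    have "0 \<le> (A * X t - \<mu> * E t)\<^sup>2 / (2 * \<mu>)" using pos by simp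
    also have "\<dots> = A\<^sup>2 / (2 * \<mu>) * (X t)\<^sup>2 - A * X t * E t + \<mu> / 2 * (E t)\<^sup>2"
      using pos by (simp add: power2_eq_square field_simps)
    finally have young: "A * X t * E t \<le> A\<^sup>2 / (2 * \<mu>) * (X t)\<^sup>2 + \<mu> / 2 * (E t)\<^sup>2" by simp
    have "B * (X t)\<^sup>2 \<le> \<bar>B\<bar> * (X t)\<^sup>2" by (intro mult_right_mono) auto
    moreover have "N * V' t \<le> N * (- c * (X t)\<^sup>2)" using V'[OF that] N(3) by (intro mult_left_mono) auto
    moreover have "D * (X t)\<^sup>2 \<le> N * c * (X t)\<^sup>2" by (intro mult_right_mono N) simp
    moreover have "D * (X t)\<^sup>2 = A\<^sup>2 / (2 * \<mu>) * (X t)\<^sup>2 + \<bar>B\<bar> * (X t)\<^sup>2 + (X t)\<^sup>2"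
      by (simp add: D_def distrib_right)
    ultimately have "N * V' t + Z' t \<le> - (X t)\<^sup>2 - \<mu> / 2 * (E t)\<^sup>2"
      using young Z'[OF that] by simp
    moreover have "\<nu> * (X t)\<^sup>2 \<le> 1 * (X t)\<^sup>2" "\<nu> * (E t)\<^sup>2 \<le> \<mu> / 2 * (E t)\<^sup>2"
      by (intro mult_right_mono; simp add: \<nu>_def)+
    ultimately have "N * V' t + Z' t \<le> - \<nu> * ((X t)\<^sup>2 + (E t)\<^sup>2)"
      by (simp add: algebra_simps)
    also have "\<nu> * W t \<le> \<nu> * (b * ((X t)\<^sup>2 + (E t)\<^sup>2))"
      using Wup[OF that] \<open>\<nu> > 0\<close> by (intro mult_left_mono) auto
    then have "- \<nu> * ((X t)\<^sup>2 + (E t)\<^sup>2) \<le> - (\<nu> / b) * W t"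
      using \<open>b > 0\<close> by (simp add: field_simps)
    finally show ?thesis .
  qed
  have "(X t)\<^sup>2 + (E t)\<^sup>2 \<le> W 0 * exp (- (\<nu> / b) * t)" if "t \<ge> 0" for t
  proof (rule order_trans[OF Wlo[OF that]], rule exponential_decay[where W = W, OF _ _ that])
    show "N * V' t + Z' t \<le> - (\<nu> / b) * W t" if "t \<ge> 0" for t by (rule W'[OF that])
    show "(W has_real_derivative N * V' t + Z' t) (at t within {0..})" if "t \<ge> 0" for t
      unfolding W_def by (intro DERIV_add DERIV_cmult V Z that)
  qed
  moreover have "W 0 \<ge> 0" using Wlo[of 0] by (smt (verit) zero_le_power2)
  ultimately show thesis using that[of "\<nu> / b" "W 0"] \<open>\<nu> > 0\<close> \<open>b > 0\<close> by simp
qed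

section \<open>The error system\<close>

lemma sum_pairs_2:
  fixes f :: "'n::finite \<times> 2 \<Rightarrow> 'b::comm_monoid_add"
  shows "(\<Sum>q\<in>UNIV. f q) = (\<Sum>i\<in>UNIV. f (i, 1) + f (i, 2))"
proof -
  have "(\<Sum>q\<in>UNIV. f q) = (\<Sum>i\<in>UNIV. \<Sum>c\<in>UNIV. f (i, c))"
    by (simp add: sum.cartesian_product)
  then show ?thesis by (simp add: sum_2)
qed

lemma norm_sq_vec: "(norm (x :: real^'m::finite))\<^sup>2 = (\<Sum>q\<in>UNIV. (x $ q)\<^sup>2)"
  unfolding power2_norm_eq_inner inner_vec_def by (simp add: power2_eq_square)

text \<open>This reduces quadratic forms of the stacked coupling to one copy of \<open>M\<close> per
  planar coordinate.\<close>

lemma kronecker_mat_1_mult: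
  "((M \<otimes>\<^sub>K (mat 1 :: real^2^2)) *v x) $ (i, c) = (M *v (\<chi> j. x $ (j, c))) $ i"
proof -
  have "c = 1 \<or> c = 2" by (rule exhaust_2)
  then show ?thesis
    by (auto simp: kronecker_def matrix_vector_mult_def sum_pairs_2 mat_def)
qed

lemma kronecker_add: "(M + N) \<otimes>\<^sub>K K = M \<otimes>\<^sub>K K + N \<otimes>\<^sub>K K"
  by (simp add: kronecker_def vec_eq_iff distrib_right)

lemma block_diag_mult:
  "(block_diag B *v v) $ (i, c) = (B i *v block v i) $ c"
proof -
  have "(block_diag B *v v) $ (i, c)
      = (\<Sum>j\<in>UNIV. \<Sum>k\<in>UNIV. if i = j then B i $ c $ k * v $ (j, k) else 0)"
    by (simp add: block_diag_def matrix_vector_mult_def sum.cartesian_product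
        case_prod_beta if_distrib[of "\<lambda>x. x * _"] cong: if_cong)
  also have "\<dots> = (\<Sum>j\<in>UNIV. if i = j then \<Sum>k\<in>UNIV. B i $ c $ k * v $ (j, k) else 0)"
    by (intro sum.cong) auto
  finally show ?thesis by (simp add: block_def matrix_vector_mult_def)
qed

lemma transpose_block_diag: "transpose (block_diag B) = block_diag (\<lambda>i. transpose (B i))"
  by (auto simp: transpose_def block_diag_def vec_eq_iff)

lemma stacked_R_mult:
  "(stacked_R l \<theta> *v v) $ (i, 1) = cos (\<theta> $ i) * v $ (i, 1) - l * sin (\<theta> $ i) * v $ (i, 2)"
  "(stacked_R l \<theta> *v v) $ (i, 2) = sin (\<theta> $ i) * v $ (i, 1) + l * cos (\<theta> $ i) * v $ (i, 2)"
  unfolding stacked_R_def block_diag_mult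
  by (simp_all add: agent_R_def matrix_vector_mult_def block_def sum_2)

lemma transpose_stacked_R_mult:
  "(transpose (stacked_R l \<theta>) *v v) $ (i, 1) = cos (\<theta> $ i) * v $ (i, 1) + sin (\<theta> $ i) * v $ (i, 2)"
  "(transpose (stacked_R l \<theta>) *v v) $ (i, 2) = - l * sin (\<theta> $ i) * v $ (i, 1) + l * cos (\<theta> $ i) * v $ (i, 2)"
  unfolding stacked_R_def transpose_block_diag block_diag_mult
  by (simp_all add: agent_R_def matrix_vector_mult_def block_def sum_2 transpose_def)

text \<open>Each block is a rotation times \<open>diag(1, l)\<close>, and the rotation preserves the
  norm. The norm is thus independent of \<open>\<theta>\<close>, which makes the following bounds
  uniform in the orientations.\<close>

lemma norm_sq_stacked_R_mult:
  "(norm (stacked_R l \<theta> *v v))\<^sup>2 = (\<Sum>i\<in>UNIV. (v $ (i, 1))\<^sup>2 + l\<^sup>2 * (v $ (i, 2))\<^sup>2)"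
proof -
  have "(cos t * a - l * sin t * b)\<^sup>2 + (sin t * a + l * cos t * b)\<^sup>2 = a\<^sup>2 + l\<^sup>2 * b\<^sup>2" for t a b
  proof -
    have "(cos t * a - l * sin t * b)\<^sup>2 + (sin t * a + l * cos t * b)\<^sup>2
        = ((sin t)\<^sup>2 + (cos t)\<^sup>2) * (a\<^sup>2 + l\<^sup>2 * b\<^sup>2)" by algebra
    then show ?thesis by simp
  qed
  then show ?thesis
    by (simp only: norm_sq_vec sum_pairs_2 stacked_R_mult)
qed

lemma norm_stacked_R_mult_le: "norm (stacked_R l \<theta> *v v) \<le> max 1 \<bar>l\<bar> * norm v"
proof (rule power2_le_imp_le)
  have "l\<^sup>2 \<le> (max 1 \<bar>l\<bar>)\<^sup>2" by (metis abs_ge_zero max.cobounded2 power2_abs power_mono)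
  moreover have "1 \<le> (max 1 \<bar>l\<bar>)\<^sup>2" by (metis max.cobounded1 one_le_power)
  ultimately show "(norm (stacked_R l \<theta> *v v))\<^sup>2 \<le> (max 1 \<bar>l\<bar> * norm v)\<^sup>2"
    unfolding norm_sq_stacked_R_mult power_mult_distrib norm_sq_vec[of v] sum_pairs_2 sum_distrib_left
      distrib_left
    by (intro sum_mono add_mono) (simp_all add: mult_right_mono mult_le_cancel_right1)
qed simp

lemma norm_stacked_R_mult_ge: "min 1 \<bar>l\<bar> * norm v \<le> norm (stacked_R l \<theta> *v v)"
proof (rule power2_le_imp_le)
  have "(min 1 \<bar>l\<bar>)\<^sup>2 \<le> \<bar>l\<bar>\<^sup>2" by (rule power_mono) auto
  then have "(min 1 \<bar>l\<bar>)\<^sup>2 \<le> l\<^sup>2" by simp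
  moreover have "(min 1 \<bar>l\<bar>)\<^sup>2 \<le> 1" by (simp add: power_le_one)
  ultimately show "(min 1 \<bar>l\<bar> * norm v)\<^sup>2 \<le> (norm (stacked_R l \<theta> *v v))\<^sup>2"
    unfolding norm_sq_stacked_R_mult power_mult_distrib norm_sq_vec[of v] sum_pairs_2 sum_distrib_left
      distrib_left
    by (intro sum_mono add_mono) (simp_all add: mult_right_mono mult_left_le_one_le)
qed simp

lemma inner_mult_transpose: "x \<bullet> (A *v (transpose A *v x)) = (norm (transpose A *v x))\<^sup>2"
  for x :: "real^'a::finite"
  by (simp only: power2_norm_eq_inner transpose_matrix_vector dot_lmul_matrix)

text \<open>Pairing \<open>x\<close> with \<open>A *v (transpose A *v x)\<close> gives the squared
  norm of \<open>transpose A *v x\<close>; Cauchy-Schwarz bounds it, and one nonzero factor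
  cancels.\<close>

lemma norm_transpose_mult_le:
  fixes A :: "real^'b::finite^'a::finite"
  assumes "\<And>v. norm (A *v v) \<le> K * norm v" and "K \<ge> 0"
  shows "norm (transpose A *v x) \<le> K * norm x"
proof (cases "transpose A *v x = 0")
  case True
  then show ?thesis using \<open>K \<ge> 0\<close> by simp
next
  case False
  have "norm (transpose A *v x) * norm (transpose A *v x) = x \<bullet> (A *v (transpose A *v x))"
    by (simp only: inner_mult_transpose power2_eq_square)
  also have "\<dots> \<le> norm x * (K * norm (transpose A *v x))"
    by (rule order_trans[OF norm_cauchy_schwarz]) (intro mult_left_mono assms norm_ge_zero)
  also have "\<dots> = K * norm x * norm (transpose A *v x)" by (simp only: ac_simps)
  finally show ?thesis using False by (simp del: transpose_matrix_vector)
qed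

section \<open>Lyapunov analysis of the error dynamics\<close>

lemma has_vector_derivative_vec_nth:
  assumes "(f has_vector_derivative f') F"
  shows "((\<lambda>t. f t $ q) has_real_derivative f' $ q) F"
  using bounded_linear.has_vector_derivative[OF bounded_linear_vec_nth assms]
  by (simp add: has_real_derivative_iff_has_vector_derivative)

text \<open>\<open>x\<close> is the position error, \<open>e\<close> the disturbance estimation
  error and \<open>v\<close> the input plus the disturbance. Since the disturbance is absorbed into
  \<open>e\<close> and \<open>v\<close>, the system is homogeneous in \<open>x\<close> and
  \<open>e\<close>.\<close>

locale error_system =
  fixes l k1 k2 c :: real and M :: "real^'n::finite^'n" and p :: "'n \<Rightarrow> real"
    and x e v :: "real \<Rightarrow> real^('n \<times> 2)" and \<theta> :: "real \<Rightarrow> real^'n"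
  assumes l: "l \<noteq> 0" and k1: "k1 > 0" and k2: "k2 > 0" and c: "c > 0" and p: "\<And>i. p i > 0"
    and coercive: "\<And>y. c * (\<Sum>i\<in>UNIV. (y $ i)\<^sup>2) \<le> (\<Sum>i\<in>UNIV. p i * y $ i * (M *v y) $ i)"
    and dx: "\<And>t. t \<ge> 0 \<Longrightarrow> (x has_vector_derivative stacked_R l (\<theta> t) *v v t) (at t within {0..})"
    and de: "\<And>t. t \<ge> 0 \<Longrightarrow>
      (e has_vector_derivative k2 *\<^sub>R (transpose (stacked_R l (\<theta> t)) *v x t)) (at t within {0..})"
    and d\<theta>: "\<And>t i. t \<ge> 0 \<Longrightarrow> ((\<lambda>\<tau>. \<theta> \<tau> $ i) has_real_derivative v t $ (i, 2)) (at t within {0..})"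
    and Rv: "\<And>t. t \<ge> 0 \<Longrightarrow> stacked_R l (\<theta> t) *v v t
      = - k1 *\<^sub>R ((M \<otimes>\<^sub>K (mat 1 :: real^2^2)) *v x t) - k2 *\<^sub>R (stacked_R l (\<theta> t) *v e t)"
begin

definition "F t = (M \<otimes>\<^sub>K (mat 1 :: real^2^2)) *v x t"
definition "w t = stacked_R l (\<theta> t) *v e t"
text \<open>The weight is the same for both coordinates of an agent and for \<open>x\<close> and
  \<open>e\<close>, so the exchange between them through \<open>R\<close> cancels agent by
  agent.\<close>

definition "V t = (\<Sum>q\<in>UNIV. p (fst q) * ((x t $ q)\<^sup>2 + (e t $ q)\<^sup>2))"
definition "V' t = (\<Sum>q\<in>UNIV. p (fst q) * (2 * x t $ q * (stacked_R l (\<theta> t) *v v t) $ q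
  + 2 * e t $ q * (k2 *\<^sub>R (transpose (stacked_R l (\<theta> t)) *v x t)) $ q))"
text \<open>
  \<open>g\<close> is \<open>R' e\<close>: the derivative of each block of \<open>R\<close> is the angular velocity times a quarter
  turn of that block.
\<close>

definition "g t = (\<chi> q :: 'n \<times> 2. if snd q = 1 then - v t $ (fst q, 2) * w t $ (fst q, 2) else v t $ (fst q, 2) * w t $ (fst q, 1))"
definition "w' t = g t + k2 *\<^sub>R (stacked_R l (\<theta> t) *v (transpose (stacked_R l (\<theta> t)) *v x t))"

lemma V_derivative:
  assumes "t \<ge> 0"
  shows "(V has_real_derivative V' t) (at t within {0..})"
  unfolding V_def V'_def
  by (rule DERIV_sum)
     (auto intro!: derivative_eq_intros has_vector_derivative_vec_nth[OF dx[OF assms]]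
        has_vector_derivative_vec_nth[OF de[OF assms]])

lemma V'_le:
  assumes "t \<ge> 0"
  shows "V' t \<le> - (2 * k1 * c) * (norm (x t))\<^sup>2"
proof -
  \<comment> \<open>The \<open>k2\<close> terms \<open>- x \<bullet> R e\<close> and
    \<open>e \<bullet> R\<^sup>T x\<close> cancel within each block. What remains splits into the
    two planar coordinates, each governed by \<open>coercive\<close>.\<close>
  have "V' t = (\<Sum>i\<in>UNIV. p i * (- 2 * k1) * (x t $ (i, 1) * F t $ (i, 1) + x t $ (i, 2) * F t $ (i, 2)))"
    unfolding V'_def sum_pairs_2 Rv[OF assms] F_def[symmetric]
    by (intro sum.cong refl)
       (simp add: stacked_R_mult transpose_stacked_R_mult algebra_simps del: transpose_matrix_vector)
  also have "\<dots> = - 2 * k1 * ((\<Sum>i\<in>UNIV. p i * (\<chi> j. x t $ (j, 1)) $ i * (M *v (\<chi> j. x t $ (j, 1))) $ i)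
      + (\<Sum>i\<in>UNIV. p i * (\<chi> j. x t $ (j, 2)) $ i * (M *v (\<chi> j. x t $ (j, 2))) $ i))"
    unfolding F_def kronecker_mat_1_mult sum_distrib_left
    by (simp add: algebra_simps sum_distrib_left flip: sum.distrib)
  also have "\<dots> \<le> - 2 * k1 * (c * (\<Sum>i\<in>UNIV. ((\<chi> j. x t $ (j, 1)) $ i)\<^sup>2)
      + c * (\<Sum>i\<in>UNIV. ((\<chi> j. x t $ (j, 2)) $ i)\<^sup>2))"
    by (intro mult_left_mono_neg add_mono coercive) (use k1 in simp)
  also have "\<dots> = - (2 * k1 * c) * (norm (x t))\<^sup>2"
    by (simp add: norm_sq_vec sum_pairs_2 sum.distrib algebra_simps)
  finally show ?thesis .
qed

lemma V_bounds:
  "Min (range p) * ((norm (x t))\<^sup>2 + (norm (e t))\<^sup>2) \<le> V t"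
  "V t \<le> Max (range p) * ((norm (x t))\<^sup>2 + (norm (e t))\<^sup>2)"
  unfolding V_def norm_sq_vec sum.distrib[symmetric] sum_distrib_left
  by (intro sum_mono mult_right_mono; simp)+

text \<open>\<open>V\<close> is nonincreasing and lies between multiples of the squared state. The
  constant depends on \<open>p\<close> alone, so the stability margin is the same for all
  solutions.\<close>

lemma state_bound:
  assumes "t \<ge> 0"
  shows "(norm (x t))\<^sup>2 + (norm (e t))\<^sup>2
    \<le> Max (range p) / Min (range p) * ((norm (x 0))\<^sup>2 + (norm (e 0))\<^sup>2)"
proof -
  have "V t \<le> V 0"
  proof (rule nonincreasing_on_halfline[OF V_derivative])
    show "V' t \<le> 0" if "t \<ge> 0" for t
      using V'_le[OF that] k1 c by (smt (verit) mult_nonneg_nonneg zero_le_power2 minus_mult_left mult_pos_pos)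
  qed (use assms in auto)
  then have "Min (range p) * ((norm (x t))\<^sup>2 + (norm (e t))\<^sup>2)
      \<le> Max (range p) * ((norm (x 0))\<^sup>2 + (norm (e 0))\<^sup>2)"
    using V_bounds(1)[of t] V_bounds(2)[of 0] by linarith
  moreover have "Min (range p) > 0" using p by auto
  ultimately show ?thesis by (simp add: field_simps)
qed

lemma w_derivative:
  assumes "t \<ge> 0"
  shows "((\<lambda>t. w t $ q) has_real_derivative w' t $ q) (at t within {0..})"
proof -
  obtain i j where q: "q = (i, j)" by fastforce
  note de' = has_vector_derivative_vec_nth[OF de[OF assms]]
  have "j = 1 \<or> j = 2" by (rule exhaust_2)
  then show ?thesis
  proof
    assume "j = 1"
    then show ?thesis
      by (auto simp: q w_def w'_def g_def stacked_R_mult transpose_stacked_R_mult algebra_simps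
          simp del: transpose_matrix_vector
          intro!: derivative_eq_intros de' d\<theta>[OF assms])
  next
    assume "j = 2"
    then show ?thesis
      by (auto simp: q w_def w'_def g_def stacked_R_mult transpose_stacked_R_mult algebra_simps
          simp del: transpose_matrix_vector
          intro!: derivative_eq_intros de' d\<theta>[OF assms])
  qed
qed

lemma cross_term_derivative:
  assumes "t \<ge> 0"
  shows "((\<lambda>t. x t \<bullet> w t) has_real_derivative (stacked_R l (\<theta> t) *v v t) \<bullet> w t + x t \<bullet> w' t) (at t within {0..})"
  unfolding inner_vec_def sum.distrib[symmetric]
  by (rule DERIV_sum)
     (auto intro!: derivative_eq_intros has_vector_derivative_vec_nth[OF dx[OF assms]] w_derivative[OF assms])

text \<open>The quarter turn keeps the norm of each block, so only the angular velocity, a component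
  of \<open>v\<close>, contributes a factor.\<close>

lemma norm_g_le:
  assumes "norm (v t) \<le> B"
  shows "norm (g t) \<le> B * norm (w t)"
proof (rule power2_le_imp_le)
  have B: "(v t $ q)\<^sup>2 \<le> B\<^sup>2" for q
    using component_le_norm_cart[of "v t" q] assms by (intro power2_le_iff_abs_le[THEN iffD2]) auto
  have "(norm (g t))\<^sup>2 = (\<Sum>i\<in>UNIV. (v t $ (i, 2))\<^sup>2 * ((w t $ (i, 1))\<^sup>2 + (w t $ (i, 2))\<^sup>2))"
    unfolding norm_sq_vec sum_pairs_2 g_def by (simp add: algebra_simps power_mult_distrib)
  also have "\<dots> \<le> (\<Sum>i\<in>UNIV. B\<^sup>2 * ((w t $ (i, 1))\<^sup>2 + (w t $ (i, 2))\<^sup>2))"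
    by (intro sum_mono mult_right_mono B) simp
  also have "\<dots> = (B * norm (w t))\<^sup>2"
    by (simp add: norm_sq_vec[of "w t"] sum_pairs_2 sum_distrib_left power_mult_distrib)
  finally show "(norm (g t))\<^sup>2 \<le> (B * norm (w t))\<^sup>2" .
  show "0 \<le> B * norm (w t)" using assms by (meson norm_ge_zero order_trans mult_nonneg_nonneg)
qed

lemma norm_w: "norm (w t) \<le> max 1 \<bar>l\<bar> * norm (e t)" "min 1 \<bar>l\<bar> * norm (e t) \<le> norm (w t)"
  unfolding w_def by (rule norm_stacked_R_mult_le norm_stacked_R_mult_ge)+

lemma F_bound: obtains m where "m \<ge> 0" "\<And>t. norm (F t) \<le> m * norm (x t)"
proof -
  have "bounded_linear ((*v) (M \<otimes>\<^sub>K (mat 1 :: real^2^2)))" by (rule matrix_vector_mul_bounded_linear)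
  from bounded_linear.nonneg_bounded[OF this] show thesis
    using that by (auto simp: F_def mult.commute)
qed

text \<open>\<open>Rv\<close> determines \<open>v\<close> only through \<open>R\<close>; the lower
  norm bound of \<open>R\<close>, positive because \<open>l\<close> is nonzero, recovers a bound on
  \<open>v\<close> itself.\<close>

lemma v_bound: obtains b where "b \<ge> 0" "\<And>t. t \<ge> 0 \<Longrightarrow> norm (v t) \<le> b * (norm (x t) + norm (e t))"
proof -
  obtain m where m: "m \<ge> 0" "\<And>t. norm (F t) \<le> m * norm (x t)" by (rule F_bound) blast
  define a where "a = k1 * m + k2 * max 1 \<bar>l\<bar>"
  have \<mu>: "min 1 \<bar>l\<bar> > 0" using l by simp
  have "norm (v t) \<le> a / min 1 \<bar>l\<bar> * (norm (x t) + norm (e t))" if "t \<ge> 0" for t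
  proof -
    have "min 1 \<bar>l\<bar> * norm (v t) \<le> norm (- k1 *\<^sub>R F t - k2 *\<^sub>R w t)"
      using norm_stacked_R_mult_ge[of l "v t" "\<theta> t"] Rv[OF that] by (simp add: F_def w_def)
    also have "\<dots> \<le> k1 * norm (F t) + k2 * norm (w t)"
      using norm_triangle_ineq4[of "- k1 *\<^sub>R F t" "k2 *\<^sub>R w t"] k1 k2 by simp
    also have "\<dots> \<le> k1 * (m * norm (x t)) + k2 * (max 1 \<bar>l\<bar> * norm (e t))"
      by (intro add_mono mult_left_mono m norm_w) (use k1 k2 in auto)
    also have "\<dots> \<le> a * norm (x t) + a * norm (e t)"
      unfolding a_def using k1 k2 m(1)
      by (intro add_mono) (simp_all add: algebra_simps mult_right_mono)
    finally show ?thesis using \<mu> by (simp add: field_simps)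
  qed
  moreover have "a / min 1 \<bar>l\<bar> \<ge> 0" using k1 k2 m(1) \<mu> by (simp add: a_def)
  ultimately show thesis by (rule that[rotated])
qed

lemma exponential_convergence:
  obtains C \<gamma> where "\<gamma> > 0" "\<And>t. t \<ge> 0 \<Longrightarrow> norm (x t) + norm (e t) \<le> C * exp (- \<gamma> * t)"
proof -
  obtain m where m: "m \<ge> 0" "\<And>t. norm (F t) \<le> m * norm (x t)" by (rule F_bound) blast
  obtain b where b: "b \<ge> 0" "\<And>t. t \<ge> 0 \<Longrightarrow> norm (v t) \<le> b * (norm (x t) + norm (e t))"
    by (rule v_bound) blast
  \<comment> \<open>The term \<open>x t \<bullet> g t\<close> is of third order in the state. The a
    priori bound \<open>\<rho>\<close> bounds \<open>v\<close> along this solution and makes the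
    term quadratic, with a constant \<open>B\<close> that depends on the initial state.\<close>
  define \<rho> where "\<rho> = sqrt (Max (range p) / Min (range p) * ((norm (x 0))\<^sup>2 + (norm (e 0))\<^sup>2))"
  have "norm (x t) \<le> \<rho>" "norm (e t) \<le> \<rho>" if "t \<ge> 0" for t
    unfolding \<rho>_def using state_bound[OF that]
    by (intro real_le_rsqrt; smt (verit) zero_le_power2)+
  then have B: "norm (v t) \<le> b * (\<rho> + \<rho>)" if "t \<ge> 0" for t
    using that b(1) by (intro order_trans[OF b(2)] mult_left_mono add_mono) auto
  define B where "B = b * (\<rho> + \<rho>)"
  define K where "K = max 1 \<bar>l\<bar>"
  have K: "K \<ge> 0" "norm (w t) \<le> K * norm (e t)" for t
    using norm_w(1) by (auto simp: K_def)
  have B0: "B \<ge> 0" unfolding B_def by (rule order_trans[OF norm_ge_zero B[OF order_refl]])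
  obtain \<gamma> C where \<gamma>: "\<gamma> > 0" "C \<ge> 0" "\<And>t. t \<ge> 0 \<Longrightarrow> (norm (x t))\<^sup>2 + (norm (e t))\<^sup>2 \<le> C * exp (- \<gamma> * t)"
  \<comment> \<open>The cross term is \<open>x t \<bullet> w t\<close>. Its derivative contains
    \<open>- k2 * (norm (w t))\<^sup>2\<close>, which supplies the damping \<open>\<mu>\<close> of
    \<open>e\<close>; \<open>A\<close> collects the coupling \<open>F\<close> and the rotation term
    \<open>g\<close>, and the other \<open>B\<close> bounds the contribution of \<open>R\<close>
    times its transpose.\<close>
  proof (rule Lyapunov_cross_term_decay[where V = V and V' = V'
        and X = "\<lambda>t. norm (x t)" and E = "\<lambda>t. norm (e t)"
        and \<alpha> = "Min (range p)" and \<beta> = "Max (range p)" and c = "2 * k1 * c"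
        and A = "(k1 * m + B) * K" and B = "k2 * K\<^sup>2" and \<mu> = "k2 * (min 1 \<bar>l\<bar>)\<^sup>2" and K = K,
        OF V_derivative cross_term_derivative])
    show "Min (range p) > 0" using p by auto
    show "2 * k1 * c > 0" using k1 c by simp
    show "k2 * (min 1 \<bar>l\<bar>)\<^sup>2 > 0" using k2 l by simp
    show "V' t \<le> - (2 * k1 * c) * (norm (x t))\<^sup>2" if "t \<ge> 0" for t by (rule V'_le[OF that])
    show "\<bar>x t \<bullet> w t\<bar> \<le> K * ((norm (x t))\<^sup>2 + (norm (e t))\<^sup>2)" for t
    proof -
      have "\<bar>x t \<bullet> w t\<bar> \<le> norm (x t) * norm (w t)" by (rule Cauchy_Schwarz_ineq2)
      also have "\<dots> \<le> K * (norm (x t) * norm (e t))"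
        using mult_left_mono[OF K(2) norm_ge_zero[of "x t"]] by (simp add: ac_simps)
      also have "\<dots> \<le> K * ((norm (x t))\<^sup>2 + (norm (e t))\<^sup>2)"
      proof (rule mult_left_mono[OF _ K(1)])
        have "0 \<le> norm (x t) * norm (e t)" by simp
        then show "norm (x t) * norm (e t) \<le> (norm (x t))\<^sup>2 + (norm (e t))\<^sup>2"
          using sum_squares_bound[of "norm (x t)" "norm (e t)"] by linarith
      qed
      finally show ?thesis .
    qed
    show "(stacked_R l (\<theta> t) *v v t) \<bullet> w t + x t \<bullet> w' t
        \<le> ((k1 * m + B) * K) * norm (x t) * norm (e t) + (k2 * K\<^sup>2) * (norm (x t))\<^sup>2
          - (k2 * (min 1 \<bar>l\<bar>)\<^sup>2) * (norm (e t))\<^sup>2" if "t \<ge> 0" for t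
    proof -
      have "(stacked_R l (\<theta> t) *v v t) \<bullet> w t = - k1 * (F t \<bullet> w t) - k2 * (norm (w t))\<^sup>2"
        by (simp add: Rv[OF that] F_def w_def inner_diff_left power2_norm_eq_inner)
      moreover have "- (F t \<bullet> w t) \<le> m * norm (x t) * (K * norm (e t))"
      proof -
        have "- (F t \<bullet> w t) \<le> norm (F t) * norm (w t)"
          using Cauchy_Schwarz_ineq2[of "F t" "w t"] by linarith
        also have "\<dots> \<le> m * norm (x t) * (K * norm (e t))"
          by (intro mult_mono m K mult_nonneg_nonneg norm_ge_zero)
        finally show ?thesis .
      qed
      then have "- k1 * (F t \<bullet> w t) \<le> k1 * (m * norm (x t) * (K * norm (e t)))"
        using mult_left_mono[of "- (F t \<bullet> w t)" _ k1] k1 by simp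
      moreover have "k2 * ((min 1 \<bar>l\<bar>)\<^sup>2 * (norm (e t))\<^sup>2) \<le> k2 * (norm (w t))\<^sup>2"
        using power_mono[OF norm_w(2)[of t], of 2] k2 l
        by (intro mult_left_mono) (simp_all add: power_mult_distrib)
      moreover have "x t \<bullet> g t \<le> norm (x t) * (B * (K * norm (e t)))"
      proof -
        have "norm (g t) \<le> B * norm (w t)" using B[OF that] unfolding B_def by (rule norm_g_le)
        also have "\<dots> \<le> B * (K * norm (e t))" by (intro mult_left_mono K B0)
        finally show ?thesis
          by (intro order_trans[OF norm_cauchy_schwarz] mult_left_mono norm_ge_zero)
      qed
      moreover have "x t \<bullet> (stacked_R l (\<theta> t) *v (transpose (stacked_R l (\<theta> t)) *v x t)) \<le> K\<^sup>2 * (norm (x t))\<^sup>2"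
        unfolding inner_mult_transpose power_mult_distrib[symmetric] K_def
        by (intro power_mono norm_transpose_mult_le norm_stacked_R_mult_le norm_ge_zero) simp
      then have "k2 * (x t \<bullet> (stacked_R l (\<theta> t) *v (transpose (stacked_R l (\<theta> t)) *v x t)))
          \<le> k2 * (K\<^sup>2 * (norm (x t))\<^sup>2)" using k2 by (intro mult_left_mono) auto
      moreover have "x t \<bullet> w' t = x t \<bullet> g t
          + k2 * (x t \<bullet> (stacked_R l (\<theta> t) *v (transpose (stacked_R l (\<theta> t)) *v x t)))"
        by (simp add: w'_def inner_add_right del: transpose_matrix_vector)
      ultimately show ?thesis by (simp add: algebra_simps del: transpose_matrix_vector)
    qed
  qed (use V_bounds in auto)
  \<comment> \<open>Passing from squared norms to norms halves the rate.\<close>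
  have "norm (x t) + norm (e t) \<le> 2 * sqrt C * exp (- (\<gamma> / 2) * t)" if "t \<ge> 0" for t
  proof -
    have *: "C * exp (- \<gamma> * t) = (sqrt C * exp (- (\<gamma> / 2) * t))\<^sup>2"
      using \<gamma>(2) by (simp add: power_mult_distrib flip: exp_double)
    have "(norm (x t))\<^sup>2 \<le> (sqrt C * exp (- (\<gamma> / 2) * t))\<^sup>2"
      and "(norm (e t))\<^sup>2 \<le> (sqrt C * exp (- (\<gamma> / 2) * t))\<^sup>2"
      using \<gamma>(3)[OF that] zero_le_power2[of "norm (x t)"] zero_le_power2[of "norm (e t)"]
      unfolding * by linarith+
    moreover have "0 \<le> sqrt C * exp (- (\<gamma> / 2) * t)" using \<gamma>(2) by simp
    ultimately have "norm (x t) \<le> sqrt C * exp (- (\<gamma> / 2) * t)"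
      and "norm (e t) \<le> sqrt C * exp (- (\<gamma> / 2) * t)"
      by (simp_all only: power2_le_imp_le)
    then show ?thesis by simp
  qed
  with \<gamma>(1) show thesis using that[of "\<gamma> / 2" "2 * sqrt C"] by simp
qed

lemma position_tendsto: "(x \<longlongrightarrow> 0) at_top"
proof -
  obtain C \<gamma> where *: "\<gamma> > 0" "\<And>t. t \<ge> 0 \<Longrightarrow> norm (x t) + norm (e t) \<le> C * exp (- \<gamma> * t)"
    by (rule exponential_convergence) blast
  show ?thesis
  proof (rule Lim_null_comparison)
    show "\<forall>\<^sub>F t in at_top. norm (x t) \<le> C * exp (- \<gamma> * t)"
      using eventually_ge_at_top[of 0]
      by eventually_elim (use *(2) norm_ge_zero in \<open>smt (verit)\<close>)
    show "((\<lambda>t. C * exp (- \<gamma> * t)) \<longlongrightarrow> 0) at_top"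
      using *(1) by (rule tendsto_exp_neg)
  qed
qed

text \<open>The angular velocity is a component of \<open>v\<close>, which is bounded by the state.
  Its exponential decay, stronger than mere convergence to zero, makes it integrable.\<close>

lemma orientation_convergent: "\<exists>c. ((\<lambda>t. \<theta> t $ i) \<longlongrightarrow> c) at_top"
proof -
  obtain C \<gamma> where *: "\<gamma> > 0" "\<And>t. t \<ge> 0 \<Longrightarrow> norm (x t) + norm (e t) \<le> C * exp (- \<gamma> * t)"
    by (rule exponential_convergence) blast
  obtain b where b: "b \<ge> 0" "\<And>t. t \<ge> 0 \<Longrightarrow> norm (v t) \<le> b * (norm (x t) + norm (e t))"
    by (rule v_bound) blast
  show ?thesis
  proof (rule convergent_if_derivative_exponentially_small[OF d\<theta> _ *(1)])
    show "\<bar>v t $ (i, 2)\<bar> \<le> b * C * exp (- \<gamma> * t)" if "t \<ge> 0" for t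
      using component_le_norm_cart[of "v t" "(i, 2)"] b(2)[OF that] mult_left_mono[OF *(2)[OF that] b(1)]
      by (simp add: mult.assoc)
  qed
qed

end

section \<open>The closed loop\<close>

text \<open>Shifting the estimate by \<open>(1 / k2) *\<^sub>R d\<close> cancels the disturbance,
  since \<open>R d\<close> equals \<open>k2\<close> times \<open>R\<close> applied to that shift. A
  constant shift leaves the derivative of the estimate unchanged.\<close>

lemma closed_loop_error_system:
  fixes num :: "'n::finite \<Rightarrow> nat" and r :: 'n and G :: "real \<Rightarrow> real^('h::finite \<times> 2)^2"
  assumes sol: "closed_loop_solution k1 k2 l a r G num \<xi> d x \<theta> \<delta> u"
    and "l \<noteq> 0" "k1 > 0" "k2 > 0" "c > 0" "\<And>i. p i > 0"
    and coercive: "\<And>y. c * (\<Sum>i\<in>UNIV. (y $ i)\<^sup>2)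
      \<le> (\<Sum>i\<in>UNIV. p i * y $ i * ((laplacian a + leader_matrix r) *v y) $ i)"
    and rank: "rank (Gbar G num) = CARD('n \<times> 2)"
  shows "error_system l k1 k2 c (laplacian a + leader_matrix r) p
    (\<lambda>t. position_error G num \<xi> (x t)) (\<lambda>t. \<delta> t - (1 / k2) *\<^sub>R d) (\<lambda>t. u t + d) \<theta>"
proof
  fix t :: real assume t: "t \<ge> 0"
  have dx: "(x has_vector_derivative stacked_R l (\<theta> t) *v (u t + d)) (at t within {0..})"
    and d\<theta>: "\<And>i. ((\<lambda>\<tau>. \<theta> \<tau> $ i) has_real_derivative u t $ (i, 2) + d $ (i, 2)) (at t within {0..})"
    and Ru: "stacked_R l (\<theta> t) *v u t = controller k1 k2 l a r G num \<xi> (x t) (\<theta> t) (\<delta> t)"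
    and d\<delta>: "(\<delta> has_vector_derivative
        k2 *\<^sub>R (transpose (stacked_R l (\<theta> t)) *v position_error G num \<xi> (x t))) (at t within {0..})"
    using sol t unfolding closed_loop_solution_def by blast+
  show "((\<lambda>t. position_error G num \<xi> (x t)) has_vector_derivative stacked_R l (\<theta> t) *v (u t + d))
      (at t within {0..})"
    unfolding position_error_def
    using has_vector_derivative_diff[OF dx has_vector_derivative_const] by simp
  show "((\<lambda>t. \<delta> t - (1 / k2) *\<^sub>R d) has_vector_derivative
      k2 *\<^sub>R (transpose (stacked_R l (\<theta> t)) *v position_error G num \<xi> (x t))) (at t within {0..})"
    using has_vector_derivative_diff[OF d\<delta> has_vector_derivative_const] by simp
  show "((\<lambda>\<tau>. \<theta> \<tau> $ i) has_real_derivative (u t + d) $ (i, 2)) (at t within {0..})" for i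
    using d\<theta> by simp
  \<comment> \<open>Full row rank makes the pseudoinverse a right inverse, so the coefficient
    feedback becomes position feedback and the Laplacian and pinning terms merge.\<close>
  have "Gbar G num *v coefficient_error G num \<xi> (x t) = position_error G num \<xi> (x t)"
    unfolding coefficient_error_def position_error_def matrix_vector_mult_diff_distrib
      matrix_vector_mul_assoc pinv_right_inverse[OF rank] matrix_vector_mul_lid ..
  then show "stacked_R l (\<theta> t) *v (u t + d)
      = - k1 *\<^sub>R ((laplacian a + leader_matrix r) \<otimes>\<^sub>K (mat 1 :: real^2^2) *v position_error G num \<xi> (x t))
        - k2 *\<^sub>R (stacked_R l (\<theta> t) *v (\<delta> t - (1 / k2) *\<^sub>R d))"
    using \<open>k2 > 0\<close>
    by (simp add: matrix_vector_right_distrib Ru controller_def kronecker_add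
        matrix_vector_mult_add_rdistrib matrix_vector_mult_diff_distrib
        matrix_vector_mult_scaleR scaleR_diff_right)
qed (use assms in auto)

theorem mainTheorem1:
  fixes num :: "'n::finite \<Rightarrow> nat" and leader :: 'n
    and a :: "real^'n^'n"
    and G :: "real \<Rightarrow> real^('h::finite \<times> 2)^2" and \<xi> :: "real^('h \<times> 2)"
    and l k1 k2 :: real and d :: "real^('n \<times> 2)"
  assumes "CARD('n) \<le> CARD('h)"
    and "bij_betw num UNIV {1..CARD('n)}" and "num leader = 1"
    and "l \<noteq> 0" and "k1 > 0" and "k2 > 0"
    and "\<And>i j. a $ i $ j \<ge> 0" and "\<And>i. a $ i $ i = 0"
    and "rooted_spanning_tree a leader"
    and "row leader (laplacian a) = 0"
    and "rank (Gbar G num) = min (2 * CARD('n)) (2 * CARD('h))"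
  shows
    "(\<forall>x \<theta> \<delta> u. closed_loop_solution k1 k2 l a leader G num \<xi> d x \<theta> \<delta> u \<longrightarrow>
        ((\<lambda>t. position_error G num \<xi> (x t)) \<longlongrightarrow> 0) at_top \<and>
        (\<forall>i. ((\<lambda>t. block (x t) i) \<longlongrightarrow> curve G \<xi> (length_param num i)) at_top))
     \<and>
     (\<forall>\<epsilon>>0. \<exists>\<eta>>0. \<forall>x \<theta> \<delta> u. closed_loop_solution k1 k2 l a leader G num \<xi> d x \<theta> \<delta> u \<longrightarrow>
        norm (position_error G num \<xi> (x 0)) + norm (\<delta> 0 - (1 / k2) *\<^sub>R d) < \<eta> \<longrightarrow>
        (\<forall>t\<ge>0. norm (position_error G num \<xi> (x t)) < \<epsilon>))
     \<and>
     (\<forall>x \<theta> \<delta> u. closed_loop_solution k1 k2 l a leader G num \<xi> d x \<theta> \<delta> u \<longrightarrow>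
        (\<forall>i. \<exists>c. ((\<lambda>t. \<theta> t $ i) \<longlongrightarrow> c) at_top))"
proof -
  have rank: "rank (Gbar G num) = CARD('n \<times> 2)"
    using assms(1,11) by simp
  obtain p c where p: "\<And>i. p i > 0" and c: "c > 0"
    and coercive: "\<And>y. c * (\<Sum>i\<in>UNIV. (y $ i)\<^sup>2)
      \<le> (\<Sum>i\<in>UNIV. p i * y $ i * ((laplacian a + leader_matrix leader) *v y) $ i)"
  proof (rule monotone_Z_matrix_diagonal_Lyapunov[of "laplacian a + leader_matrix leader"])
    show "(laplacian a + leader_matrix leader) $ i $ j \<le> 0" if "i \<noteq> j" for i j
      using that assms(7)[of i j] by (auto simp: laplacian_def leader_matrix_def)
    show "y $ i \<ge> 0" if "\<And>i. ((laplacian a + leader_matrix leader) *v y) $ i \<ge> 0" for y i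
      using assms(7-10) that by (rule pinned_laplacian_mono)
  qed (rule that, assumption+)
  \<comment> \<open>The overshoot factor from \<open>state_bound\<close>, fixed before any solution
    so that \<open>\<epsilon> / \<kappa>\<close> serves as a uniform \<open>\<eta>\<close>.\<close>
  define \<kappa> where "\<kappa> = sqrt (Max (range p) / Min (range p))"
  have "Max (range p) / Min (range p) > 0"
    using p by (intro divide_pos_pos) (auto simp: Max_gr_iff)
  then have \<kappa>: "\<kappa> > 0" "\<kappa>\<^sup>2 = Max (range p) / Min (range p)"
    unfolding \<kappa>_def by (simp_all only: real_sqrt_gt_zero real_sqrt_pow2 less_imp_le)
  have limits: "((\<lambda>t. position_error G num \<xi> (x t)) \<longlongrightarrow> 0) at_top"
      "((\<lambda>t. block (x t) i) \<longlongrightarrow> curve G \<xi> (length_param num i)) at_top"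
      "\<exists>c. ((\<lambda>t. \<theta> t $ i) \<longlongrightarrow> c) at_top"
    and bound: "\<And>t. t \<ge> 0 \<Longrightarrow> norm (position_error G num \<xi> (x t))
      \<le> \<kappa> * (norm (position_error G num \<xi> (x 0)) + norm (\<delta> 0 - (1 / k2) *\<^sub>R d))"
    if sol: "closed_loop_solution k1 k2 l a leader G num \<xi> d x \<theta> \<delta> u" for x \<theta> \<delta> u i
  proof -
    interpret error_system l k1 k2 c "laplacian a + leader_matrix leader" p
        "\<lambda>t. position_error G num \<xi> (x t)" "\<lambda>t. \<delta> t - (1 / k2) *\<^sub>R d" "\<lambda>t. u t + d" \<theta>
      by (rule closed_loop_error_system[OF sol assms(4-6) c p coercive rank])
    show lim: "((\<lambda>t. position_error G num \<xi> (x t)) \<longlongrightarrow> 0) at_top"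
      by (rule position_tendsto)
    show "\<exists>c. ((\<lambda>t. \<theta> t $ i) \<longlongrightarrow> c) at_top" by (rule orientation_convergent)
    show "((\<lambda>t. block (x t) i) \<longlongrightarrow> curve G \<xi> (length_param num i)) at_top"
    proof (rule vec_tendstoI)
      fix j
      have "((\<lambda>t. position_error G num \<xi> (x t) $ (i, j) + (Gbar G num *v \<xi>) $ (i, j))
          \<longlongrightarrow> 0 $ (i, j) + (Gbar G num *v \<xi>) $ (i, j)) at_top"
        by (intro tendsto_add tendsto_vec_nth lim tendsto_const)
      then show "((\<lambda>t. block (x t) i $ j) \<longlongrightarrow> curve G \<xi> (length_param num i) $ j) at_top"
        by (simp add: position_error_def block_def curve_def Gbar_def matrix_vector_mult_def)
    qed
    fix t :: real assume "t \<ge> 0"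
    let ?a = "norm (position_error G num \<xi> (x 0))" and ?b = "norm (\<delta> 0 - (1 / k2) *\<^sub>R d)"
    have "(norm (position_error G num \<xi> (x t)))\<^sup>2 \<le> \<kappa>\<^sup>2 * (?a\<^sup>2 + ?b\<^sup>2)"
      using state_bound[OF \<open>t \<ge> 0\<close>] zero_le_power2[of "norm (\<delta> t - (1 / k2) *\<^sub>R d)"]
      unfolding \<kappa>(2) by linarith
    \<comment> \<open>For nonnegative numbers the sum of squares is at most the square of the sum,
      which passes to the sum of norms used to measure the initial state.\<close>
    also have "\<dots> \<le> \<kappa>\<^sup>2 * (?a + ?b)\<^sup>2"
      by (intro mult_left_mono) (simp_all add: power2_sum)
    also have "\<dots> = (\<kappa> * (?a + ?b))\<^sup>2" by (simp add: power_mult_distrib)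
    finally show "norm (position_error G num \<xi> (x t)) \<le> \<kappa> * (?a + ?b)"
      by (rule power2_le_imp_le) (use \<kappa>(1) in simp)
  qed
  have stable: "\<exists>\<eta>>0. \<forall>x \<theta> \<delta> u. closed_loop_solution k1 k2 l a leader G num \<xi> d x \<theta> \<delta> u \<longrightarrow>
      norm (position_error G num \<xi> (x 0)) + norm (\<delta> 0 - (1 / k2) *\<^sub>R d) < \<eta> \<longrightarrow>
      (\<forall>t\<ge>0. norm (position_error G num \<xi> (x t)) < \<epsilon>)" if "\<epsilon> > 0" for \<epsilon>
  proof (intro exI[of _ "\<epsilon> / \<kappa>"] conjI allI impI)
    fix x \<theta> \<delta> u and t :: real
    assume sol: "closed_loop_solution k1 k2 l a leader G num \<xi> d x \<theta> \<delta> u" and "t \<ge> 0"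
      and small: "norm (position_error G num \<xi> (x 0)) + norm (\<delta> 0 - (1 / k2) *\<^sub>R d) < \<epsilon> / \<kappa>"
    have "\<kappa> * (norm (position_error G num \<xi> (x 0)) + norm (\<delta> 0 - (1 / k2) *\<^sub>R d)) < \<epsilon>"
      using mult_strict_left_mono[OF small \<kappa>(1)] \<kappa>(1) by simp
    then show "norm (position_error G num \<xi> (x t)) < \<epsilon>"
      using bound[OF sol \<open>t \<ge> 0\<close>] by linarith
  qed (use that \<kappa>(1) in simp)
  show ?thesis
    using limits stable by (intro conjI allI impI) blast+
qed

end
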